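(* Let $(D,G_o)$ be a two-sender unicast index-coding problem, with arbitrary (fully or partially participated) interaction between its sub-digraphs $D_1,D_2,D_3$. If the three-vertex digraph $f(D)$ is acyclic (contains no directed cycle, where a pair of opposite arcs counts as a directed cycle), then $$\beta(D,G_o)=\beta(D_1)+\beta(D_2)+\beta(D_3)=\beta(D).$$
   Context: There are $N$ messages $\mathcal{M}=\{x_1,\dots,x_N\}$, $x_i\in\{0,1\}^t$, and $N$ receivers; receiver $r$ requests $x_r$ and knows $\{x_j: j\in N_D^+(r)\}$, where $D$ is a loopless digraph on $V(D)=\{1,\dots,N\}$ (the side-information digraph) and $N_D^+(r)$ is the out-neighborhood of $r$. Single sender: an index code is an encoding function of all messages into $\{0,1\}^p$ together with decoding functions by which every receiver $r$ recovers $x_r$, for all message realizations, from the codeword and its side information. $\beta_t(D)$ is the minimum of $p/t$ over index codes for $t$-bit messages, and $\beta(D)=\inf_t\beta_t(D)=\lim_{t\to\infty}\beta_t(D)$. (The empty digraph has rate $0$.) Two senders: senders $S_1,S_2$ know $\mathcal{M}_1,\mathcal{M}_2$ with $\mathcal{M}_1\cup\mathcal{M}_2=\mathcal{M}$. A two-sender index code consists of encoding functions $\mathscr{F}_s:\{0,1\}^{|\mathcal{M}_s|t}\to\{0,1\}^{p_s}$, $s=1,2$ ($p_s\ge0$ an integer), and decoding functions by which every receiver $r$ recovers $x_r$, for all message realizations, from both sub-codewords and its side information. $\beta_t(D,G_o)$ is the minimum of $(p_1+p_2)/t$ over two-sender index codes for $t$-bit messages, and $\beta(D,G_o)=\inf_t\beta_t(D,G_o)=\lim_{t\to\infty}\beta_t(D,G_o)$.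 Here $G_o$ (the sender-constraint graph, with vertex set $V(D)$ and an edge $ij$ iff one of $x_i,x_j$ is in $\mathcal{M}_1\setminus\mathcal{M}_2$ and the other in $\mathcal{M}_2\setminus\mathcal{M}_1$) records the senders' message sets. Let $\mathcal{P}_1=\mathcal{M}_1\setminus\mathcal{M}_2$, $\mathcal{P}_2=\mathcal{M}_2\setminus\mathcal{M}_1$, $\mathcal{P}_3=\mathcal{M}_1\cap\mathcal{M}_2$. For $i\in\{1,2,3\}$, $D_i$ is the sub-digraph of $D$ induced by $\{j:x_j\in\mathcal{P}_i\}$. The digraph $f(D)$ has vertex set $\{1,2,3\}$, and $(i,j)$, $i\neq j$, is an arc of $f(D)$ iff there is an arc of $D$ from some vertex of $D_i$ to some vertex of $D_j$. The interaction is called fully participated if, whenever $(i,j)$ is an arc of $f(D)$, every vertex of $D_i$ has arcs to all vertices of $D_j$; otherwise it is partially participated. *)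

theory Defs
  imports Complex_Main "HOL-Library.FuncSet" "Graph_Theory.Graph_Theory"
begin

text \<open>
  A message is identified with the vertex (receiver) that requests it.  The messages known to a
  sender or a receiver are given as the restriction of the full realization to a set of vertices,
  so encoders and decoders depend on nothing else.
\<close>

definition bit_strings :: "nat \<Rightarrow> bool list set" where
  "bit_strings n = {w. length w = n}"

definition realizations :: "nat \<Rightarrow> 'a set \<Rightarrow> ('a \<Rightarrow> bool list) set" where
  "realizations t S = S \<rightarrow>\<^sub>E bit_strings t"

definition out_neighborhood :: "('a, 'b) pre_digraph \<Rightarrow> 'a \<Rightarrow> 'a set" where
  "out_neighborhood D r = {j. r \<rightarrow>\<^bsub>D\<^esub> j}"

definition index_code ::
  "('a, 'b) pre_digraph \<Rightarrow> nat \<Rightarrow> nat \<Rightarrow> (('a \<Rightarrow> bool list) \<Rightarrow> bool list) \<Rightarrow>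
   ('a \<Rightarrow> bool list \<Rightarrow> ('a \<Rightarrow> bool list) \<Rightarrow> bool list) \<Rightarrow> bool" where
  "index_code D t p enc dec \<longleftrightarrow>
     enc \<in> realizations t (verts D) \<rightarrow> bit_strings p \<and>
     (\<forall>x \<in> realizations t (verts D). \<forall>r \<in> verts D.
        dec r (enc x) (restrict x (out_neighborhood D r)) = x r)"

definition rate_t :: "nat \<Rightarrow> ('a, 'b) pre_digraph \<Rightarrow> real" where
  "rate_t t D = real (LEAST p. \<exists>enc dec. index_code D t p enc dec) / real t"

definition rate :: "('a, 'b) pre_digraph \<Rightarrow> real" where
  "rate D = (INF t \<in> {1..}. rate_t t D)"

definition two_sender_index_code ::
  "('a, 'b) pre_digraph \<Rightarrow> 'a set \<Rightarrow> 'a set \<Rightarrow> nat \<Rightarrow> nat \<Rightarrow> nat \<Rightarrow>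
   (('a \<Rightarrow> bool list) \<Rightarrow> bool list) \<Rightarrow> (('a \<Rightarrow> bool list) \<Rightarrow> bool list) \<Rightarrow>
   ('a \<Rightarrow> bool list \<Rightarrow> bool list \<Rightarrow> ('a \<Rightarrow> bool list) \<Rightarrow> bool list) \<Rightarrow> bool" where
  "two_sender_index_code D M1 M2 t p1 p2 enc1 enc2 dec \<longleftrightarrow>
     enc1 \<in> realizations t M1 \<rightarrow> bit_strings p1 \<and>
     enc2 \<in> realizations t M2 \<rightarrow> bit_strings p2 \<and>
     (\<forall>x \<in> realizations t (verts D). \<forall>r \<in> verts D.
        dec r (enc1 (restrict x M1)) (enc2 (restrict x M2))
          (restrict x (out_neighborhood D r)) = x r)"

definition two_sender_rate_t ::
  "nat \<Rightarrow> ('a, 'b) pre_digraph \<Rightarrow> 'a set \<Rightarrow> 'a set \<Rightarrow> real" where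
  "two_sender_rate_t t D M1 M2 =
     real (LEAST p. \<exists>p1 p2 enc1 enc2 dec. p = p1 + p2 \<and>
             two_sender_index_code D M1 M2 t p1 p2 enc1 enc2 dec) / real t"

definition two_sender_rate :: "('a, 'b) pre_digraph \<Rightarrow> 'a set \<Rightarrow> 'a set \<Rightarrow> real" where
  "two_sender_rate D M1 M2 = (INF t \<in> {1..}. two_sender_rate_t t D M1 M2)"

text \<open>Only the indices 1, 2 and 3 are used.\<close>

definition message_class :: "'a set \<Rightarrow> 'a set \<Rightarrow> nat \<Rightarrow> 'a set" where
  "message_class M1 M2 i = (if i = 1 then M1 - M2 else if i = 2 then M2 - M1 else M1 \<inter> M2)"

definition class_subgraph ::
  "('a, 'b) pre_digraph \<Rightarrow> 'a set \<Rightarrow> 'a set \<Rightarrow> nat \<Rightarrow> ('a, 'b) pre_digraph" where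
  "class_subgraph D M1 M2 i = D \<restriction> message_class M1 M2 i"

definition interaction_digraph ::
  "('a, 'b) pre_digraph \<Rightarrow> 'a set \<Rightarrow> 'a set \<Rightarrow> (nat, nat \<times> nat) pre_digraph" where
  "interaction_digraph D M1 M2 =
     \<lparr> verts = {1, 2, 3},
       arcs = {(i, j). i \<in> {1, 2, 3} \<and> j \<in> {1, 2, 3} \<and> i \<noteq> j \<and>
                 (\<exists>u \<in> verts (class_subgraph D M1 M2 i).
                  \<exists>v \<in> verts (class_subgraph D M1 M2 j). u \<rightarrow>\<^bsub>D\<^esub> v)},
       tail = fst,
       head = snd \<rparr>"

text \<open>
  The cycles of the library are nonempty and include those of length 2 (pairs of opposite arcs).
\<close>

definition acyclic_digraph :: "('a, 'b) pre_digraph \<Rightarrow> bool" where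
  "acyclic_digraph G \<longleftrightarrow> (\<nexists>c. pre_digraph.cycle G c)"

lemma inj_realizations:
  assumes "finite S"
  obtains g where "g \<in> realizations t S \<rightarrow> bit_strings (t * card S)"
    "inj_on g (realizations t S)"
proof -
  have c: "finite (bit_strings n)" "card (bit_strings n) = 2 ^ n" for n
    using finite_lists_length_eq[of "UNIV :: bool set" n]
      card_lists_length_eq[of "UNIV :: bool set" n]
    by (simp_all add: bit_strings_def)
  have "finite (realizations t S)"
    unfolding realizations_def using assms c by (intro finite_PiE) auto
  moreover have "card (realizations t S) = card (bit_strings (t * card S))"
    unfolding realizations_def using assms c by (simp add: card_PiE power_mult)
  ultimately obtain g where
    "g ` realizations t S \<subseteq> bit_strings (t * card S)" "inj_on g (realizations t S)"
    using c card_le_inj[of "realizations t S" "bit_strings (t * card S)"] by auto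
  then show thesis by (intro that[of g]) auto
qed

lemma index_code_exists:
  assumes "finite (verts D)"
  shows "\<exists>p enc dec. index_code D t p enc dec"
proof -
  let ?R = "realizations t (verts D)"
  obtain g where "g \<in> ?R \<rightarrow> bit_strings (t * card (verts D))" "inj_on g ?R"
    using inj_realizations assms by blast
  then have "index_code D t (t * card (verts D)) g (\<lambda>r c y. inv_into ?R g c r)"
    by (simp add: index_code_def)
  then show ?thesis by blast
qed

lemma two_sender_index_code_exists:
  assumes "finite (verts D)" "M1 \<union> M2 = verts D"
  shows "\<exists>p1 p2 enc1 enc2 dec. two_sender_index_code D M1 M2 t p1 p2 enc1 enc2 dec"
proof -
  have fin: "finite M1" "finite M2" using assms by (metis finite_Un)+
  obtain g where g: "g \<in> realizations t M1 \<rightarrow> bit_strings (t * card M1)"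
    "inj_on g (realizations t M1)"
    using inj_realizations fin by blast
  obtain h where h: "h \<in> realizations t M2 \<rightarrow> bit_strings (t * card M2)"
    "inj_on h (realizations t M2)"
    using inj_realizations fin by blast
  have sub: "restrict x S \<in> realizations t S"
    if "x \<in> realizations t (verts D)" "S \<subseteq> verts D" for x and S
    using that by (auto simp: realizations_def)
  define dec where "dec = (\<lambda>r c d (y :: 'a \<Rightarrow> bool list).
    if r \<in> M1 then inv_into (realizations t M1) g c r else inv_into (realizations t M2) h d r)"
  have "dec r (g (restrict x M1)) (h (restrict x M2)) (restrict x (out_neighborhood D r)) = x r"
    if "x \<in> realizations t (verts D)" "r \<in> verts D" for x r
  proof -
    have "M1 \<subseteq> verts D" "M2 \<subseteq> verts D" and r: "r \<in> M1 \<or> r \<in> M2"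
      using assms(2) that(2) by auto
    then have "restrict x M1 \<in> realizations t M1" "restrict x M2 \<in> realizations t M2"
      using that(1) sub by blast+
    then show ?thesis using r g(2) h(2) by (auto simp: dec_def)
  qed
  then have "two_sender_index_code D M1 M2 t (t * card M1) (t * card M2) g h dec"
    using g(1) h(1) by (simp add: two_sender_index_code_def)
  then show ?thesis by blast
qed

end

theory Submission
  imports Defs
begin

text \<open>
  An index code is a proper colouring of the confusion graph, whose vertices are the realizations
  and whose edges join two realizations that some receiver must tell apart although its side
  information is the same in both.  If no receiver in \<open>B\<close> knows a message of \<open>A\<close>, then the confusion
  graph of \<open>A \<union> B\<close> contains the lexicographic product of those of \<open>B\<close> and \<open>A\<close>.  A colouring with
  \<open>2 ^ p\<close> colours uses at least \<open>a\<close> of them on each copy of the graph of \<open>A\<close>, where \<open>a\<close> is its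
  chromatic number, so by double counting some colour gives an independent set in the graph of \<open>B\<close>
  of density at least \<open>a / 2 ^ p\<close>.  Translates of this set under bitwise exclusive or are again
  independent, and greedily \<open>O(t \<cdot> 2 ^ p / a)\<close> of them cover everything.  Hence the code lengths add
  up to a term logarithmic in \<open>t\<close>, and rates are superadditive.  Applied twice along a topological
  order of the interaction digraph, this bounds the single-sender rate from below by the sum of the
  three rates; sending the three codes side by side bounds the two-sender rate from above by the
  same sum.
\<close>

section \<open>Decoder-free codes: colourings of confusion graphs\<close>

text \<open>Decoders are eliminated: one exists exactly when codeword and side information determine
  the requested message. The colour type stays free because colours other than bit strings occur
  later, and \<open>K\<close> is not tied to a digraph so that the vertex set can vary while side
  information stays fixed.\<close>

definition separates ::
  "('a \<Rightarrow> 'a set) \<Rightarrow> 'a set \<Rightarrow> nat \<Rightarrow> (('a \<Rightarrow> bool list) \<Rightarrow> 'c) \<Rightarrow> bool" where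
  "separates K S t f \<longleftrightarrow>
     (\<forall>x \<in> realizations t S. \<forall>y \<in> realizations t S. \<forall>r \<in> S.
        f x = f y \<longrightarrow> (\<forall>j \<in> K r. x j = y j) \<longrightarrow> x r = y r)"

definition code_length :: "('a \<Rightarrow> 'a set) \<Rightarrow> 'a set \<Rightarrow> nat \<Rightarrow> nat" where
  "code_length K S t = (LEAST p. \<exists>f \<in> realizations t S \<rightarrow> bit_strings p. separates K S t f)"

definition code_rate :: "('a \<Rightarrow> 'a set) \<Rightarrow> 'a set \<Rightarrow> real" where
  "code_rate K S = (INF t \<in> {1..}. real (code_length K S t) / real t)"

lemma separatesI:
  assumes "\<And>x y r. \<lbrakk>x \<in> realizations t S; y \<in> realizations t S; r \<in> S; f x = f y;
      \<And>j. j \<in> K r \<Longrightarrow> x j = y j\<rbrakk> \<Longrightarrow> x r = y r"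
  shows "separates K S t f"
  using assms unfolding separates_def by blast

lemma separatesD:
  assumes "separates K S t f" "x \<in> realizations t S" "y \<in> realizations t S" "f x = f y" "r \<in> S"
    "\<And>j. j \<in> K r \<Longrightarrow> x j = y j"
  shows "x r = y r"
  using assms unfolding separates_def by blast

lemma finite_bit_strings: "finite (bit_strings n)"
  and card_bit_strings: "card (bit_strings n) = 2 ^ n"
  using finite_lists_length_eq[of "UNIV :: bool set" n]
    card_lists_length_eq[of "UNIV :: bool set" n]
  by (simp_all add: bit_strings_def)

lemma finite_realizations: "finite S \<Longrightarrow> finite (realizations t S)"
  unfolding realizations_def by (intro finite_PiE) (auto simp: finite_bit_strings)

lemma card_realizations: "finite S \<Longrightarrow> card (realizations t S) = 2 ^ (t * card S)"
  unfolding realizations_def by (simp add: card_PiE card_bit_strings power_mult)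

lemma restrict_realizations:
  "x \<in> realizations t S \<Longrightarrow> A \<subseteq> S \<Longrightarrow> restrict x A \<in> realizations t A"
  by (auto simp: realizations_def)

lemma realizations_length: "x \<in> realizations t S \<Longrightarrow> j \<in> S \<Longrightarrow> length (x j) = t"
  by (auto simp: realizations_def bit_strings_def)

lemma realizations_outside: "x \<in> realizations t S \<Longrightarrow> j \<notin> S \<Longrightarrow> x j = undefined"
  by (auto simp: realizations_def)

lemma code_length_attained:
  assumes "finite S"
  obtains f where "f \<in> realizations t S \<rightarrow> bit_strings (code_length K S t)" "separates K S t f"
proof -
  obtain g where "g \<in> realizations t S \<rightarrow> bit_strings (t * card S)" "inj_on g (realizations t S)"
    using inj_realizations assms by blast
  moreover from this(2) have "separates K S t g"
    by (intro separatesI) (auto dest: inj_onD)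
  ultimately have "\<exists>p. \<exists>f \<in> realizations t S \<rightarrow> bit_strings p. separates K S t f" by blast
  from LeastI_ex[OF this] show thesis
    using that unfolding code_length_def by blast
qed

lemma code_length_le:
  "f \<in> realizations t S \<rightarrow> bit_strings p \<Longrightarrow> separates K S t f \<Longrightarrow> code_length K S t \<le> p"
  unfolding code_length_def by (rule Least_le) blast

text \<open>Only the number of colours matters, since up to \<open>2 ^ p\<close> of them can be
  renamed injectively as bit strings of length \<open>p\<close>.\<close>

lemma code_length_le_colours:
  assumes "finite S" "separates K S t f" "card (f ` realizations t S) \<le> 2 ^ p"
  shows "code_length K S t \<le> p"
proof -
  have "finite (f ` realizations t S)" using assms(1) by (simp add: finite_realizations)
  then obtain g where g: "g ` f ` realizations t S \<subseteq> bit_strings p" "inj_on g (f ` realizations t S)"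
    using card_le_inj[OF _ finite_bit_strings] assms(3) card_bit_strings by metis
  have "separates K S t (g \<circ> f)"
  proof (rule separatesI)
    fix x y r
    assume xy: "x \<in> realizations t S" "y \<in> realizations t S" "r \<in> S" "(g \<circ> f) x = (g \<circ> f) y"
      and K: "\<And>j. j \<in> K r \<Longrightarrow> x j = y j"
    have "f x = f y" using xy by (intro inj_onD[OF g(2)]) auto
    then show "x r = y r" using separatesD[OF assms(2) xy(1,2) _ xy(3)] K by blast
  qed
  moreover have "g \<circ> f \<in> realizations t S \<rightarrow> bit_strings p" using g(1) by auto
  ultimately show ?thesis by (rule code_length_le[rotated])
qed

text \<open>If at most half of \<open>2 ^ code_length K S t\<close> colours were used, one bit could
  be saved. The factor 2 is the price of measuring chromatic numbers in whole bits.\<close>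

lemma separates_colours_ge:
  assumes "finite S" "separates K S t f"
  shows "2 ^ code_length K S t \<le> 2 * card (f ` realizations t S)"
proof (cases "code_length K S t")
  \<comment> \<open>No shorter length exists to compare with; here a nonempty image is
    enough.\<close>
  case 0
  have "realizations t S \<noteq> {}"
    using card_realizations[OF assms(1), of t] by auto
  then have "card (f ` realizations t S) > 0"
    using assms(1) by (simp add: finite_realizations card_gt_0_iff)
  then show ?thesis using 0 by simp
next
  case (Suc p)
  then have "\<not> card (f ` realizations t S) \<le> 2 ^ p"
    using code_length_le_colours[OF assms, of p] by linarith
  then show ?thesis using Suc by simp
qed

section \<open>Subadditivity in the message length and approximation of rates\<close>

text \<open>The first \<open>s\<close> bits and the last \<open>t\<close> bits of every message are
  encoded separately and the codewords concatenated.\<close>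

lemma code_length_add:
  assumes "finite S"
  shows "code_length K S (s + t) \<le> code_length K S s + code_length K S t"
proof -
  obtain f where f: "f \<in> realizations s S \<rightarrow> bit_strings (code_length K S s)" "separates K S s f"
    using code_length_attained[OF assms] .
  obtain g where g: "g \<in> realizations t S \<rightarrow> bit_strings (code_length K S t)" "separates K S t g"
    using code_length_attained[OF assms] .
  define T where "T = (\<lambda>x. \<lambda>j\<in>S. take s (x j :: bool list))"
  define U where "U = (\<lambda>x. \<lambda>j\<in>S. drop s (x j :: bool list))"
  have TU: "T x \<in> realizations s S" "U x \<in> realizations t S" if "x \<in> realizations (s + t) S" for x
    using that by (auto simp: T_def U_def realizations_def bit_strings_def PiE_iff)
  let ?h = "\<lambda>x. f (T x) @ g (U x)"
  have "?h \<in> realizations (s + t) S \<rightarrow> bit_strings (code_length K S s + code_length K S t)"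
    using TU f(1) g(1) by (fastforce simp: bit_strings_def Pi_iff)
  moreover have "separates K S (s + t) ?h"
  proof (rule separatesI)
    fix x y r
    assume xy: "x \<in> realizations (s + t) S" "y \<in> realizations (s + t) S" and r: "r \<in> S"
      and h: "?h x = ?h y" and K: "\<And>j. j \<in> K r \<Longrightarrow> x j = y j"
    \<comment> \<open>The first codeword has fixed length, so equality of the concatenations
      splits.\<close>
    have "length (f (T x)) = length (f (T y))"
      using TU xy f(1) by (auto simp: bit_strings_def Pi_iff)
    then have "f (T x) = f (T y)" "g (U x) = g (U y)" using h by auto
    moreover have "T x j = T y j" "U x j = U y j" if "j \<in> K r" for j
      using K[OF that] by (auto simp: T_def U_def)
    ultimately have "T x r = T y r" "U x r = U y r"
      using separatesD[OF f(2) TU(1) TU(1)] separatesD[OF g(2) TU(2) TU(2)] xy r by blast+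
    then show "x r = y r"
      using r by (auto simp: T_def U_def) (metis append_take_drop_id)
  qed
  ultimately show ?thesis by (rule code_length_le)
qed

lemma code_length_mult:
  assumes "finite S"
  shows "code_length K S (k * t) \<le> k * code_length K S t"
proof (induction k)
  case 0
  \<comment> \<open>Messages of length 0 are all empty, so there is nothing to transmit.\<close>
  have "code_length K S 0 \<le> 0"
  proof (rule code_length_le)
    show "(\<lambda>x. []) \<in> realizations 0 S \<rightarrow> bit_strings 0" by (simp add: bit_strings_def)
    show "separates K S 0 (\<lambda>x. [] :: bool list)"
      by (rule separatesI) (metis realizations_length length_0_conv)
  qed
  then show ?case by simp
next
  case (Suc k)
  then show ?case using code_length_add[OF assms, of K t "k * t"] by simp
qed

lemma code_rate_le: "t \<ge> 1 \<Longrightarrow> code_rate K S \<le> real (code_length K S t) / real t"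
  unfolding code_rate_def by (rule cINF_lower) (auto intro!: bdd_belowI2[where m = 0])

lemma code_rate_approx:
  assumes "e > 0"
  obtains t where "t \<ge> 1" "real (code_length K S t) / real t < code_rate K S + e"
proof -
  have "bdd_below ((\<lambda>t. real (code_length K S t) / real t) ` {1..})"
    by (rule bdd_belowI2[where m = 0]) simp
  moreover have "(INF t \<in> {1..}. real (code_length K S t) / real t) < code_rate K S + e"
    using assms by (simp add: code_rate_def)
  ultimately have "\<exists>t \<in> {1..}. real (code_length K S t) / real t < code_rate K S + e"
    by (subst (asm) cINF_less_iff) simp_all
  then show thesis using that by auto
qed

text \<open>A near-optimal message length can be replaced by any multiple of it without loss. This
  is used both to reach a common multiple of several lengths and to let a length grow.\<close>

lemma code_length_mult_rate:
  assumes "finite S" "k \<ge> 1" "t \<ge> 1"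
  shows "real (code_length K S (k * t)) / real (k * t) \<le> real (code_length K S t) / real t"
proof -
  have "real (code_length K S (k * t)) \<le> real k * real (code_length K S t)"
    using code_length_mult[OF assms(1), of K k t] by (metis of_nat_le_iff of_nat_mult)
  then show ?thesis using assms by (simp add: field_simps)
qed

section \<open>Double counting and greedy covering\<close>

lemma sum_card_swap:
  assumes "finite A" "finite B"
  shows "(\<Sum>a\<in>A. card {b \<in> B. R a b}) = (\<Sum>b\<in>B. card {a \<in> A. R a b})"
  using sum.swap_restrict[OF assms, of "\<lambda>_ _. 1::nat" R] by simp

text \<open>By averaging, some \<open>T g\<close> contains at least a fraction \<open>1 / c\<close>
  of the points still uncovered, so each greedy choice shrinks their number by a factor of at most
  \<open>1 - 1 / c\<close>.\<close>

lemma greedy_cover: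
  fixes T :: "'i \<Rightarrow> 'x set" and c :: real
  assumes "finite X" "finite G" "G \<noteq> {}" "c \<ge> 1"
    and dense: "\<And>u. u \<in> X \<Longrightarrow> real (card G) \<le> c * real (card {g \<in> G. u \<in> T g})"
  shows "\<exists>H \<subseteq> G. card H \<le> k \<and> real (card (X - \<Union> (T ` H))) \<le> real (card X) * (1 - 1 / c) ^ k"
proof (induction k)
  case 0
  show ?case by (intro exI[of _ "{}"]) simp
next
  case (Suc k)
  then obtain H where H: "H \<subseteq> G" "card H \<le> k"
    "real (card (X - \<Union> (T ` H))) \<le> real (card X) * (1 - 1 / c) ^ k" by blast
  define U where "U = X - \<Union> (T ` H)"
  have U: "finite U" "U \<subseteq> X" using assms(1) by (auto simp: U_def)
  \<comment> \<open>Incidences between \<open>U\<close> and the sets \<open>T g\<close> are counted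
    from both sides: if every \<open>T g\<close> took less than its share of \<open>U\<close>, the
    density of the family at the points of \<open>U\<close> would be violated.\<close>
  have "\<exists>g \<in> G. real (card U) \<le> c * real (card (U \<inter> T g))"
  proof (rule ccontr)
    assume "\<not> ?thesis"
    then have "(\<Sum>g\<in>G. c * real (card (U \<inter> T g))) < (\<Sum>g\<in>G. real (card U))"
      using assms(2,3) by (intro sum_strict_mono) auto
    also have "\<dots> = (\<Sum>u\<in>U. real (card G))" by simp
    also have "\<dots> \<le> (\<Sum>u\<in>U. c * real (card {g \<in> G. u \<in> T g}))"
      using U dense by (intro sum_mono) blast
    also have "\<dots> = c * real (\<Sum>u\<in>U. card {g \<in> G. u \<in> T g})" by (simp add: sum_distrib_left)
    also have "(\<Sum>u\<in>U. card {g \<in> G. u \<in> T g}) = (\<Sum>g\<in>G. card {u \<in> U. u \<in> T g})"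
      using U(1) assms(2) by (rule sum_card_swap)
    finally show False by (simp add: sum_distrib_left Collect_conj_eq)
  qed
  then obtain g where g: "g \<in> G" "real (card U) \<le> c * real (card (U \<inter> T g))" by blast
  have "card (U - T g) + card (U \<inter> T g) = card U"
    using card_Int_Diff[OF U(1)] by (simp add: add.commute)
  then have "real (card (U - T g)) = real (card U) - real (card (U \<inter> T g))" by linarith
  also have "\<dots> \<le> real (card U) * (1 - 1 / c)"
    using g(2) assms(4) by (simp add: field_simps)
  also have "\<dots> \<le> real (card X) * (1 - 1 / c) ^ k * (1 - 1 / c)"
    using H(3) assms(4) by (intro mult_right_mono) (auto simp: U_def)
  finally have "real (card (U - T g)) \<le> real (card X) * (1 - 1 / c) ^ Suc k" by (simp add: ac_simps)
  moreover have "U - T g = X - \<Union> (T ` insert g H)" by (auto simp: U_def)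
  moreover have "card (insert g H) \<le> Suc k"
    using H(2) card_insert_le_m1[of "Suc k" H g] by simp
  ultimately show ?case using H(1) g(1) by (intro exI[of _ "insert g H"]) auto
qed

text \<open>Since \<open>1 - 1 / c\<close> is at most \<open>exp (- 1 / c)\<close>, the strict bound
  on \<open>k\<close> leaves fewer than one uncovered point, hence none.\<close>

lemma cover_exists:
  fixes T :: "'i \<Rightarrow> 'x set" and c :: real
  assumes "finite X" "finite G" "G \<noteq> {}" "c \<ge> 1"
    and dense: "\<And>u. u \<in> X \<Longrightarrow> real (card G) \<le> c * real (card {g \<in> G. u \<in> T g})"
    and k: "c * ln (real (card X)) < real k"
  obtains H where "H \<subseteq> G" "card H \<le> k" "X \<subseteq> \<Union> (T ` H)"
proof -
  obtain H where H: "H \<subseteq> G" "card H \<le> k"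
    "real (card (X - \<Union> (T ` H))) \<le> real (card X) * (1 - 1 / c) ^ k"
    using greedy_cover[OF assms(1-5)] by blast
  have "X \<subseteq> \<Union> (T ` H)"
  proof (cases "X = {}")
    case False
    then have X: "real (card X) > 0" using assms(1) by (simp add: card_gt_0_iff)
    have "(1 - 1 / c) ^ k \<le> exp (- 1 / c) ^ k"
      using assms(4) exp_ge_add_one_self[of "- 1 / c"] by (intro power_mono) auto
    also have "\<dots> = exp (- (real k / c))" by (simp flip: exp_of_nat_mult)
    also have "\<dots> < exp (- ln (real (card X)))" using k assms(4) by (simp add: field_simps)
    also have "\<dots> = 1 / real (card X)" using X by (simp add: exp_minus field_simps)
    finally have "real (card X) * (1 - 1 / c) ^ k < 1" using X by (simp add: field_simps)
    then have "card (X - \<Union> (T ` H)) = 0" using H(3) by linarith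
    then show ?thesis using assms(1) by auto
  qed simp
  with H that show thesis by blast
qed

section \<open>Translates of independent sets\<close>

text \<open>On bits, \<open>(\<noteq>)\<close> is exclusive or.\<close>

definition translate ::
  "'a set \<Rightarrow> ('a \<Rightarrow> bool list) \<Rightarrow> ('a \<Rightarrow> bool list) \<Rightarrow> 'a \<Rightarrow> bool list" where
  "translate S g x = (\<lambda>j\<in>S. map2 (\<noteq>) (g j) (x j))"

lemma map2_neq_cancel: "length a = length b \<Longrightarrow> map2 (\<noteq>) a (map2 (\<noteq>) a b) = b"
  by (induction a b rule: list_induct2) auto

lemma map2_neq_commute: "map2 (\<noteq>) a b = map2 (\<noteq>) b (a :: bool list)"
  by (rule nth_equalityI) auto

lemma translate_realizations:
  "g \<in> realizations t S \<Longrightarrow> x \<in> realizations t S \<Longrightarrow> translate S g x \<in> realizations t S"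
  by (auto simp: translate_def realizations_def bit_strings_def PiE_iff)

lemma translate_commute: "translate S g x = translate S x g"
  unfolding translate_def using map2_neq_commute by (metis (no_types))

lemma translate_cancel:
  assumes "g \<in> realizations t S" "x \<in> realizations t S"
  shows "translate S g (translate S g x) = x"
proof
  fix j
  show "translate S g (translate S g x) j = x j"
  proof (cases "j \<in> S")
    case True
    then have "length (g j) = length (x j)" using assms by (simp add: realizations_length[of _ t S])
    from map2_neq_cancel[OF this] show ?thesis using True by (simp add: translate_def)
  next
    case False
    then show ?thesis using assms(2) by (simp add: translate_def realizations_outside)
  qed
qed

text \<open>The translate of \<open>v\<close> by \<open>g\<close> is \<open>u\<close> exactly when
  \<open>g\<close> is the translate of \<open>v\<close> by \<open>u\<close>. So translation by
  \<open>u\<close> is an involution matching \<open>I\<close> with the relevant \<open>g\<close>,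
  and all points lie in equally many translates: the uniform density that the covering argument
  needs.\<close>

lemma card_translates_containing:
  assumes "u \<in> realizations t S" "I \<subseteq> realizations t S"
  shows "card {g \<in> realizations t S. u \<in> translate S g ` I} = card I"
proof -
  have "bij_betw (translate S u) I {g \<in> realizations t S. u \<in> translate S g ` I}"
  proof (rule bij_betw_byWitness[where f' = "translate S u"])
    show "\<forall>a\<in>I. translate S u (translate S u a) = a"
      using assms translate_cancel by blast
    show "\<forall>g\<in>{g \<in> realizations t S. u \<in> translate S g ` I}. translate S u (translate S u g) = g"
      using assms(1) translate_cancel by blast
    show "translate S u ` I \<subseteq> {g \<in> realizations t S. u \<in> translate S g ` I}"
    proof
      fix g assume "g \<in> translate S u ` I"
      then obtain v where v: "v \<in> I" "g = translate S u v" by blast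
      then have "v \<in> realizations t S" using assms(2) by blast
      then have "translate S g v = u" "g \<in> realizations t S"
        using v(2) assms(1) translate_cancel[of v t S u] translate_realizations[of u t S v]
        by (simp_all add: translate_commute)
      then show "g \<in> {g \<in> realizations t S. u \<in> translate S g ` I}" using v(1) by auto
    qed
    show "translate S u ` {g \<in> realizations t S. u \<in> translate S g ` I} \<subseteq> I"
    proof clarify
      fix g v assume gv: "g \<in> realizations t S" "v \<in> I"
      then have "v \<in> realizations t S" using assms(2) by blast
      then show "translate S (translate S g v) g \<in> I"
        using gv translate_cancel[of g t S v] by (simp add: translate_commute)
    qed
  qed
  then show ?thesis by (simp add: bij_betw_same_card)
qed

definition independent_set ::
  "('a \<Rightarrow> 'a set) \<Rightarrow> 'a set \<Rightarrow> ('a \<Rightarrow> bool list) set \<Rightarrow> bool" where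
  "independent_set K S I \<longleftrightarrow>
     (\<forall>x \<in> I. \<forall>y \<in> I. \<forall>r \<in> S. (\<forall>j \<in> K r. x j = y j) \<longrightarrow> x r = y r)"

text \<open>Exclusive or with a fixed \<open>g\<close> preserves equality and inequality in every
  coordinate, and independence speaks of nothing else.\<close>

lemma independent_set_translate:
  assumes "independent_set K S I" "I \<subseteq> realizations t S" "g \<in> realizations t S"
  shows "independent_set K S (translate S g ` I)"
proof -
  have eq: "translate S g x j = translate S g y j \<longleftrightarrow> x j = y j" if "x \<in> I" "y \<in> I" for x y j
  proof (cases "j \<in> S")
    case True
    have "length (g j) = length (x j)" "length (g j) = length (y j)"
      using True that assms(2,3) realizations_length by (metis subsetD)+
    then have "map2 (\<noteq>) (g j) (x j) = map2 (\<noteq>) (g j) (y j) \<longleftrightarrow> x j = y j"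
      using map2_neq_cancel by metis
    then show ?thesis using True by (simp add: translate_def)
  next
    case False
    then have "x j = y j" using that assms(2) realizations_outside by (metis subsetD)
    then show ?thesis using False by (simp add: translate_def)
  qed
  show ?thesis
    using assms(1) unfolding independent_set_def by (auto simp: eq)
qed

text \<open>The set \<open>I\<close> has density at least \<open>1 / 2 ^ q\<close>, and the
  logarithm of the number of realizations is below \<open>2 ^ h\<close>. Greedy covering with
  \<open>c = 2 ^ q\<close> therefore needs at most \<open>2 ^ (q + h)\<close> translates, which
  serve as colours.\<close>

lemma code_length_le_independent_set:
  assumes "finite S" "independent_set K S I" "I \<subseteq> realizations t S"
    and size: "2 ^ (t * card S) \<le> 2 ^ q * card I"
    and h: "t * card S < 2 ^ h"
  shows "code_length K S t \<le> q + h"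
proof -
  let ?R = "realizations t S"
  have R: "finite ?R" "?R \<noteq> {}"
    using finite_realizations[OF assms(1)] card_realizations[OF assms(1), of t] by auto
  have "ln (real (card ?R)) = real (t * card S) * ln 2"
    by (simp add: card_realizations[OF assms(1)] ln_realpow)
  also have "\<dots> \<le> real (t * card S)" using ln_2_less_1 by (simp add: mult_left_le)
  also have "\<dots> < real (2 ^ h)" using h by (simp only: of_nat_less_iff)
  finally have ln: "2 ^ q * ln (real (card ?R)) < real (2 ^ (q + h))" by (simp add: power_add)
  have dense: "real (card ?R) \<le> 2 ^ q * real (card {g \<in> ?R. u \<in> translate S g ` I})"
    if "u \<in> ?R" for u
  proof -
    have "real (2 ^ (t * card S)) \<le> real (2 ^ q * card I)" using size by (simp only: of_nat_le_iff)
    then show ?thesis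
      by (simp add: card_translates_containing[OF that assms(3)] card_realizations[OF assms(1)])
  qed
  have "(1::real) \<le> 2 ^ q" by simp
  from cover_exists[OF R(1) R this dense ln]
  obtain H where H: "H \<subseteq> ?R" "card H \<le> 2 ^ (q + h)"
    "?R \<subseteq> \<Union> ((\<lambda>g. translate S g ` I) ` H)" by blast
  \<comment> \<open>The colour of \<open>x\<close> is some chosen translate containing it, so each
    colour class lies inside an independent set.\<close>
  define f where "f = (\<lambda>x. SOME g. g \<in> H \<and> x \<in> translate S g ` I)"
  have f: "f x \<in> H \<and> x \<in> translate S (f x) ` I" if "x \<in> ?R" for x
  proof -
    have "\<exists>g. g \<in> H \<and> x \<in> translate S g ` I" using H(3) that by blast
    then show ?thesis unfolding f_def by (rule someI_ex)
  qed
  have "separates K S t f"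
  proof (rule separatesI)
    fix x y r
    assume x: "x \<in> ?R" and y: "y \<in> ?R" and r: "r \<in> S" and eq: "f x = f y"
      and K: "\<And>j. j \<in> K r \<Longrightarrow> x j = y j"
    have "independent_set K S (translate S (f x) ` I)"
      using independent_set_translate[OF assms(2,3)] f[OF x] H(1) by blast
    moreover have "x \<in> translate S (f x) ` I" "y \<in> translate S (f x) ` I"
      using f[OF x] f[OF y] eq by auto
    ultimately show "x r = y r" using r K unfolding independent_set_def by blast
  qed
  moreover have "card (f ` ?R) \<le> 2 ^ (q + h)"
    using card_mono[of H "f ` ?R"] f H(1,2) R(1) finite_subset by fastforce
  ultimately show ?thesis using code_length_le_colours assms(1) by blast
qed

section \<open>Superadditivity when one part knows nothing of the other\<close>

text \<open>In the error term, the 1 comes from rounding the chromatic number for \<open>A\<close>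
  to a power of two and \<open>h\<close> from the covering for \<open>B\<close>.\<close>

lemma code_length_split:
  assumes fin: "finite A" "finite B" and disj: "A \<inter> B = {}"
    and K: "\<And>r. r \<in> B \<Longrightarrow> K r \<inter> A = {}"
    and h: "t * card B < 2 ^ h"
  shows "code_length K A t + code_length K B t \<le> code_length K (A \<union> B) t + 1 + h"
proof -
  let ?p = "code_length K (A \<union> B) t" and ?a = "code_length K A t"
  let ?RA = "realizations t A" and ?RB = "realizations t B"
  obtain f where f: "f \<in> realizations t (A \<union> B) \<rightarrow> bit_strings ?p" "separates K (A \<union> B) t f"
    using code_length_attained[of "A \<union> B"] fin by blast
  define merge where "merge = (\<lambda>u v j. if j \<in> A then u j else v j :: bool list)"
  have merge: "merge u v \<in> realizations t (A \<union> B)" if "u \<in> ?RA" "v \<in> ?RB" for u v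
    using that by (auto simp: merge_def realizations_def PiE_iff extensional_def)
  \<comment> \<open>The colours occurring on the copy of the confusion graph of \<open>A\<close>
    that lies over \<open>v\<close>. With \<open>v\<close> fixed, receivers in \<open>A\<close>
    cannot distinguish two realizations by messages of \<open>B\<close>, so \<open>f\<close>
    properly colours this copy.\<close>
  define C where "C = (\<lambda>v. (\<lambda>u. f (merge u v)) ` ?RA)"
  have C: "2 ^ ?a \<le> 2 * card (C v)" if v: "v \<in> ?RB" for v
    unfolding C_def
  proof (rule separates_colours_ge[OF fin(1)], rule separatesI)
    fix x y r
    assume xy: "x \<in> ?RA" "y \<in> ?RA" "r \<in> A" "f (merge x v) = f (merge y v)"
      and eq: "\<And>j. j \<in> K r \<Longrightarrow> x j = y j"
    have "merge x v r = merge y v r"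
    proof (rule separatesD[OF f(2), OF merge[OF xy(1) v] merge[OF xy(2) v] xy(4)])
      show "merge x v j = merge y v j" if "j \<in> K r" for j
        using eq[OF that] by (simp add: merge_def)
    qed (use xy(3) in simp)
    then show "x r = y r" using xy(3) by (simp add: merge_def)
  qed
  define I where "I = (\<lambda>c. {v \<in> ?RB. c \<in> C v})"
  \<comment> \<open>Colour \<open>c\<close> may be attained over \<open>x\<close> and over
    \<open>y\<close> with different messages on \<open>A\<close>. Receivers in \<open>B\<close> know
    none of these, so \<open>f\<close> must still separate \<open>x\<close> from
    \<open>y\<close>.\<close>
  have indep: "independent_set K B (I c)" for c
    unfolding independent_set_def
  proof (intro ballI impI)
    fix x y r
    assume xy: "x \<in> I c" "y \<in> I c" and r: "r \<in> B" and eq: "\<forall>j\<in>K r. x j = y j"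
    then obtain u v where uv: "u \<in> ?RA" "v \<in> ?RA" "f (merge u x) = f (merge v y)"
      by (auto simp: I_def C_def)
    have RB: "x \<in> ?RB" "y \<in> ?RB" using xy by (auto simp: I_def)
    have "merge u x r = merge v y r"
    proof (rule separatesD[OF f(2), OF merge[OF uv(1) RB(1)] merge[OF uv(2) RB(2)] uv(3)])
      show "merge u x j = merge v y j" if "j \<in> K r" for j
        using K[OF r] that eq by (auto simp: merge_def)
    qed (use r in simp)
    moreover have "r \<notin> A" using r disj by blast
    ultimately show "x r = y r" by (simp add: merge_def)
  qed
  \<comment> \<open>Pigeonhole: the sizes of \<open>C v\<close> summed over \<open>v\<close> equal
    the sizes of \<open>I c\<close> summed over the \<open>2 ^ ?p\<close> colours, and each
    \<open>C v\<close> has at least half of \<open>2 ^ ?a\<close> elements.\<close>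
  have "\<exists>c. 2 ^ ?a * card ?RB \<le> 2 ^ (?p + 1) * card (I c)"
  proof (rule ccontr)
    assume "\<not> ?thesis"
    then have less: "2 ^ (?p + 1) * card (I c) < 2 ^ ?a * card ?RB" for c by (simp add: not_le)
    have sub: "C v \<subseteq> bit_strings ?p" if "v \<in> ?RB" for v
      using f(1) merge that by (auto simp: C_def)
    have "2 ^ ?p * (2 ^ ?a * card ?RB) = 2 ^ ?p * (\<Sum>v\<in>?RB. 2 ^ ?a)" by simp
    also have "\<dots> \<le> 2 ^ ?p * (\<Sum>v\<in>?RB. 2 * card (C v))"
      using C by (intro mult_left_mono sum_mono) auto
    also have "\<dots> = 2 ^ (?p + 1) * (\<Sum>v\<in>?RB. card (C v))" by (simp flip: sum_distrib_left)
    also have "(\<Sum>v\<in>?RB. card (C v)) = (\<Sum>v\<in>?RB. card {c \<in> bit_strings ?p. c \<in> C v})"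
      using sub by (intro sum.cong refl arg_cong[where f = card]) blast
    also have "\<dots> = (\<Sum>c\<in>bit_strings ?p. card (I c))"
      unfolding I_def using finite_realizations[OF fin(2)] finite_bit_strings by (rule sum_card_swap)
    also have "2 ^ (?p + 1) * \<dots> = (\<Sum>c\<in>bit_strings ?p. 2 ^ (?p + 1) * card (I c))"
      by (simp add: sum_distrib_left)
    also have "\<dots> < (\<Sum>c\<in>bit_strings ?p. 2 ^ ?a * card ?RB)"
      using less card_bit_strings[of ?p] by (intro sum_strict_mono finite_bit_strings) auto
    also have "\<dots> = 2 ^ ?p * (2 ^ ?a * card ?RB)" by (simp add: card_bit_strings)
    finally show False by simp
  qed
  then obtain c where c: "2 ^ ?a * card ?RB \<le> 2 ^ (?p + 1) * card (I c)" by blast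
  \<comment> \<open>This yields \<open>?a \<le> ?p + 1\<close>, so that the natural-number
    subtraction in \<open>?p + 1 - ?a\<close> is exact.\<close>
  have "card (I c) \<le> card ?RB"
    using finite_realizations[OF fin(2)] by (intro card_mono) (auto simp: I_def)
  then have "2 ^ ?a * card ?RB \<le> 2 ^ (?p + 1) * card ?RB"
    using c mult_le_mono2 order_trans by blast
  then have "(2::nat) ^ ?a \<le> 2 ^ (?p + 1)"
    by (simp add: card_realizations[OF fin(2)])
  then have a: "?a \<le> ?p + 1" by (rule power_le_imp_le_exp[rotated]) simp
  then have "(2::nat) ^ (?p + 1) = 2 ^ ?a * 2 ^ (?p + 1 - ?a)" by (simp flip: power_add)
  then have "2 ^ ?a * card ?RB \<le> 2 ^ ?a * (2 ^ (?p + 1 - ?a) * card (I c))"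
    using c by (simp only: mult.assoc)
  then have "2 ^ (t * card B) \<le> 2 ^ (?p + 1 - ?a) * card (I c)"
    by (simp add: card_realizations[OF fin(2)])
  then have "code_length K B t \<le> (?p + 1 - ?a) + h"
    using fin(2) indep h by (intro code_length_le_independent_set[where I = "I c"]) (auto simp: I_def)
  then show ?thesis using a by simp
qed

text \<open>Doubling the message length raises the covering exponent by only one. Along
  \<open>2 ^ i * t\<close> the additive error is thus linear in \<open>i\<close>, and it vanishes
  after division by the message length.\<close>

lemma code_rate_split:
  assumes fin: "finite A" "finite B" and disj: "A \<inter> B = {}"
    and K: "\<And>r. r \<in> B \<Longrightarrow> K r \<inter> A = {}"
  shows "code_rate K A + code_rate K B \<le> code_rate K (A \<union> B)"
proof (rule field_le_epsilon)
  fix e :: real assume "e > 0"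
  then obtain t where t: "t \<ge> 1"
    "real (code_length K (A \<union> B) t) / real t < code_rate K (A \<union> B) + e"
    by (rule code_rate_approx)
  \<comment> \<open>Any exponent would do; this one works because \<open>n < 2 ^ n\<close>.\<close>
  define h where "h = t * card B"
  have h: "t * card B < 2 ^ h" by (simp add: h_def)
  have bound: "code_rate K A + code_rate K B
      \<le> code_rate K (A \<union> B) + e + (1 + real h + real i) / 2 ^ i" for i
  proof -
    let ?T = "2 ^ i * t"
    have T: "?T \<ge> 1" using t by simp
    have "?T * card B < 2 ^ (i + h)" using h by (simp add: power_add mult.assoc)
    from code_length_split[where K = K, OF fin disj K this]
    have "code_length K A ?T + code_length K B ?T
        \<le> code_length K (A \<union> B) ?T + 1 + (i + h)" by blast
    then have "real (code_length K A ?T) + real (code_length K B ?T)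
        \<le> real (code_length K (A \<union> B) ?T) + (1 + real h + real i)" by linarith
    then have "real (code_length K A ?T) / real ?T + real (code_length K B ?T) / real ?T
        \<le> real (code_length K (A \<union> B) ?T) / real ?T + (1 + real h + real i) / real ?T"
      by (simp only: divide_right_mono of_nat_0_le_iff flip: add_divide_distrib)
    moreover have "real (code_length K (A \<union> B) ?T) / real ?T
        \<le> real (code_length K (A \<union> B) t) / real t"
      using fin t(1) by (intro code_length_mult_rate) auto
    moreover have "(1 + real h + real i) / real ?T \<le> (1 + real h + real i) / 2 ^ i"
      using t(1) by (intro divide_left_mono) auto
    ultimately show ?thesis
      using code_rate_le[OF T, of K A] code_rate_le[OF T, of K B] t(2) by linarith
  qed
  have "(\<lambda>i. (1 + real h + real i) / 2 ^ i) \<longlonglongrightarrow> 0"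
  proof -
    have "(\<lambda>i. (1 + real h) * (1 / 2) ^ i + real i * (1 / 2) ^ i) \<longlonglongrightarrow> (1 + real h) * 0 + 0"
      by (intro tendsto_intros LIMSEQ_power_zero powser_times_n_limit_0) auto
    then show ?thesis by (simp add: power_divide add_divide_distrib)
  qed
  then have "(\<lambda>i. code_rate K (A \<union> B) + e + (1 + real h + real i) / 2 ^ i)
      \<longlonglongrightarrow> code_rate K (A \<union> B) + e + 0"
    by (intro tendsto_intros)
  then show "code_rate K A + code_rate K B \<le> code_rate K (A \<union> B) + e"
    using bound by (intro LIMSEQ_le_const[where X = "\<lambda>i. _ i"]) auto
qed

section \<open>Rates of digraphs as code rates\<close>

lemma index_code_iff_separates:
  "(\<exists>enc dec. index_code D t p enc dec) \<longleftrightarrow>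
   (\<exists>f \<in> realizations t (verts D) \<rightarrow> bit_strings p. separates (out_neighborhood D) (verts D) t f)"
    (is "?L \<longleftrightarrow> ?R")
proof
  assume ?L
  then obtain enc dec where c: "index_code D t p enc dec" by blast
  have "separates (out_neighborhood D) (verts D) t enc"
  proof (rule separatesI)
    fix x y r
    assume "x \<in> realizations t (verts D)" "y \<in> realizations t (verts D)" "r \<in> verts D"
      "enc x = enc y" and "\<And>j. j \<in> out_neighborhood D r \<Longrightarrow> x j = y j"
    moreover from this(5)
    have "restrict x (out_neighborhood D r) = restrict y (out_neighborhood D r)" by auto
    ultimately show "x r = y r" using c unfolding index_code_def by metis
  qed
  then show ?R using c unfolding index_code_def by blast
next
  assume ?R
  then obtain f where f: "f \<in> realizations t (verts D) \<rightarrow> bit_strings p"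
    "separates (out_neighborhood D) (verts D) t f" by blast
  \<comment> \<open>The decoder picks any realization consistent with codeword and side information;
    separation makes its value at \<open>r\<close> the correct one.\<close>
  define dec where "dec = (\<lambda>r c z. (SOME x. x \<in> realizations t (verts D) \<and> f x = c \<and>
    restrict x (out_neighborhood D r) = z) r)"
  have "dec r (f x) (restrict x (out_neighborhood D r)) = x r"
    if "x \<in> realizations t (verts D)" "r \<in> verts D" for x r
    unfolding dec_def
  proof (rule someI2[of _ x])
    fix y
    assume y: "y \<in> realizations t (verts D) \<and> f y = f x \<and>
      restrict y (out_neighborhood D r) = restrict x (out_neighborhood D r)"
    then have "y j = x j" if "j \<in> out_neighborhood D r" for j using that by (metis restrict_apply')
    then show "y r = x r" using separatesD[OF f(2)] y that by blast
  qed (use that in auto)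
  then show ?L using f(1) unfolding index_code_def by blast
qed

text \<open>
  Realizations of \<open>S\<close> are undefined outside \<open>S\<close>, so side information outside \<open>S\<close> is vacuous.  This
  lets an induced subgraph keep the neighborhoods of the whole digraph.
\<close>

lemma separates_cong:
  assumes "\<And>r. r \<in> S \<Longrightarrow> K r \<inter> S = K' r \<inter> S"
  shows "separates K S t f \<longleftrightarrow> separates K' S t f"
proof -
  have "(\<forall>j\<in>K r. x j = y j) \<longleftrightarrow> (\<forall>j\<in>K' r. x j = y j)"
    if "x \<in> realizations t S" "y \<in> realizations t S" "r \<in> S" for x y r
  proof -
    have "x j = y j" if "j \<notin> S" for j
      using that \<open>x \<in> _\<close> \<open>y \<in> _\<close> by (simp add: realizations_outside)
    then show ?thesis using assms[OF that(3)] by blast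
  qed
  then show ?thesis unfolding separates_def by (auto 0 4)
qed

lemma rate_eq_code_rate: "rate D = code_rate (out_neighborhood D) (verts D)"
  by (simp add: rate_def rate_t_def code_rate_def code_length_def index_code_iff_separates)

lemma rate_induced: "rate (D \<restriction> S) = code_rate (out_neighborhood D) S"
proof -
  have "out_neighborhood (D \<restriction> S) r \<inter> S = out_neighborhood D r \<inter> S" if "r \<in> S" for r
    using that
    by (auto simp: out_neighborhood_def arcs_ends_def arc_to_ends_def image_iff)
  then have "separates (out_neighborhood (D \<restriction> S)) S t f \<longleftrightarrow> separates (out_neighborhood D) S t f"
    for t and f :: "('a \<Rightarrow> bool list) \<Rightarrow> bool list"
    by (rule separates_cong)
  then show ?thesis
    by (simp add: rate_eq_code_rate code_rate_def code_length_def)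
qed

section \<open>Two-sender codes compared with single-sender codes\<close>

definition two_sender_length :: "('a, 'b) pre_digraph \<Rightarrow> 'a set \<Rightarrow> 'a set \<Rightarrow> nat \<Rightarrow> nat" where
  "two_sender_length D M1 M2 t = (LEAST p. \<exists>p1 p2 enc1 enc2 dec. p = p1 + p2 \<and>
     two_sender_index_code D M1 M2 t p1 p2 enc1 enc2 dec)"

lemma two_sender_rate_alt:
  "two_sender_rate D M1 M2 = (INF t \<in> {1..}. real (two_sender_length D M1 M2 t) / real t)"
  by (simp add: two_sender_rate_def two_sender_rate_t_def two_sender_length_def)

text \<open>A single sender can simulate both by concatenating the sub-codewords, whose fixed
  lengths make them recoverable.\<close>

lemma code_length_le_two_sender:
  assumes "finite (verts D)" "M1 \<union> M2 = verts D"
  shows "code_length (out_neighborhood D) (verts D) t \<le> two_sender_length D M1 M2 t"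
proof -
  have "\<exists>p1 p2 enc1 enc2 dec. two_sender_length D M1 M2 t = p1 + p2 \<and>
      two_sender_index_code D M1 M2 t p1 p2 enc1 enc2 dec"
    unfolding two_sender_length_def
    by (rule LeastI_ex) (use two_sender_index_code_exists[OF assms, of t] in metis)
  then obtain p1 p2 enc1 enc2 dec where
    p: "two_sender_length D M1 M2 t = p1 + p2"
    and c: "two_sender_index_code D M1 M2 t p1 p2 enc1 enc2 dec"
    by metis
  have enc: "enc1 (restrict x M1) \<in> bit_strings p1" "enc2 (restrict x M2) \<in> bit_strings p2"
    if "x \<in> realizations t (verts D)" for x
    using c restrict_realizations[OF that] assms(2) unfolding two_sender_index_code_def by blast+
  let ?f = "\<lambda>x. enc1 (restrict x M1) @ enc2 (restrict x M2)"
  have "?f \<in> realizations t (verts D) \<rightarrow> bit_strings (p1 + p2)"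
    using enc by (auto simp: bit_strings_def)
  moreover have "separates (out_neighborhood D) (verts D) t ?f"
  proof (rule separatesI)
    fix x y r
    assume xy: "x \<in> realizations t (verts D)" "y \<in> realizations t (verts D)" "r \<in> verts D"
      and eq: "?f x = ?f y" and K: "\<And>j. j \<in> out_neighborhood D r \<Longrightarrow> x j = y j"
    have "restrict x (out_neighborhood D r) = restrict y (out_neighborhood D r)" using K by auto
    moreover have "enc1 (restrict x M1) = enc1 (restrict y M1)"
      "enc2 (restrict x M2) = enc2 (restrict y M2)"
      using eq enc[OF xy(1)] enc[OF xy(2)] by (auto simp: bit_strings_def)
    ultimately show "x r = y r" using c xy unfolding two_sender_index_code_def by metis
  qed
  ultimately show ?thesis unfolding p by (rule code_length_le)
qed

text \<open>The three classes are encoded independently, each receiver using only the code of its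
  own class.\<close>

lemma two_sender_length_le:
  assumes "finite (verts D)" "M1 \<union> M2 = verts D"
  shows "two_sender_length D M1 M2 t \<le> code_length (out_neighborhood D) (M1 - M2) t
    + code_length (out_neighborhood D) (M2 - M1) t + code_length (out_neighborhood D) (M1 \<inter> M2) t"
proof -
  let ?K = "out_neighborhood D" and ?R = "realizations t (verts D)"
  let ?P1 = "M1 - M2" and ?P2 = "M2 - M1" and ?P3 = "M1 \<inter> M2"
  have fin: "finite M1" "finite M2" using assms by (metis finite_Un)+
  obtain f1 where f1: "f1 \<in> realizations t ?P1 \<rightarrow> bit_strings (code_length ?K ?P1 t)"
    "separates ?K ?P1 t f1" using code_length_attained fin by (metis finite_Diff)
  obtain f2 where f2: "f2 \<in> realizations t ?P2 \<rightarrow> bit_strings (code_length ?K ?P2 t)"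
    "separates ?K ?P2 t f2" using code_length_attained fin by (metis finite_Diff)
  obtain f3 where f3: "f3 \<in> realizations t ?P3 \<rightarrow> bit_strings (code_length ?K ?P3 t)"
    "separates ?K ?P3 t f3" using code_length_attained fin by (metis finite_Int)
  \<comment> \<open>Both senders know the common class; its codeword is assigned to the
    first.\<close>
  define enc1 where "enc1 = (\<lambda>z. f1 (restrict z ?P1) @ f3 (restrict z ?P3))"
  define enc2 where "enc2 = (\<lambda>z. f2 (restrict z ?P2))"
  have sub: "?P1 \<subseteq> verts D" "?P2 \<subseteq> verts D" "?P3 \<subseteq> verts D" using assms(2) by auto
  have eqD: "x r = y r"
    if xy: "x \<in> ?R" "y \<in> ?R" and r: "r \<in> verts D"
      and e: "enc1 (restrict x M1) = enc1 (restrict y M1)" "enc2 (restrict x M2) = enc2 (restrict y M2)"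
      and K: "restrict x (?K r) = restrict y (?K r)" for x y r
  proof -
    have int: "M1 \<inter> ?P1 = ?P1" "M1 \<inter> ?P3 = ?P3" "M2 \<inter> ?P2 = ?P2" by auto
    have "length (f1 (restrict x ?P1)) = length (f1 (restrict y ?P1))"
      using f1(1) restrict_realizations[OF _ sub(1)] xy by (auto simp: bit_strings_def Pi_iff)
    then have f: "f1 (restrict x ?P1) = f1 (restrict y ?P1)"
      "f3 (restrict x ?P3) = f3 (restrict y ?P3)" "f2 (restrict x ?P2) = f2 (restrict y ?P2)"
      using e by (auto simp: enc1_def enc2_def int)
    \<comment> \<open>Side information from other classes becomes \<open>undefined\<close> on both
      sides after restriction, so agreement on \<open>?K r\<close> suffices for the code of any one
      class.\<close>
    have Kj: "restrict x P j = restrict y P j" if "j \<in> ?K r" for j P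
      using K that by (metis restrict_apply)
    consider "r \<in> ?P1" | "r \<in> ?P2" | "r \<in> ?P3" using r assms(2) by blast
    then show ?thesis
    proof cases
      case 1
      with separatesD[OF f1(2), OF _ _ f(1) _ Kj] restrict_realizations[OF _ sub(1)] xy
      have "restrict x ?P1 r = restrict y ?P1 r" by blast
      with 1 show ?thesis by simp
    next
      case 2
      with separatesD[OF f2(2), OF _ _ f(3) _ Kj] restrict_realizations[OF _ sub(2)] xy
      have "restrict x ?P2 r = restrict y ?P2 r" by blast
      with 2 show ?thesis by simp
    next
      case 3
      with separatesD[OF f3(2), OF _ _ f(2) _ Kj] restrict_realizations[OF _ sub(3)] xy
      have "restrict x ?P3 r = restrict y ?P3 r" by blast
      with 3 show ?thesis by simp
    qed
  qed
  define dec where "dec = (\<lambda>r c d z. (SOME x. x \<in> ?R \<and> enc1 (restrict x M1) = c \<and>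
    enc2 (restrict x M2) = d \<and> restrict x (?K r) = z) r)"
  have "dec r (enc1 (restrict x M1)) (enc2 (restrict x M2)) (restrict x (?K r)) = x r"
    if "x \<in> ?R" "r \<in> verts D" for x r
    unfolding dec_def by (rule someI2[of _ x]) (use that eqD in blast)+
  moreover have "enc1 \<in> realizations t M1 \<rightarrow> bit_strings (code_length ?K ?P1 t + code_length ?K ?P3 t)"
  proof
    fix z assume "z \<in> realizations t M1"
    then have "restrict z ?P1 \<in> realizations t ?P1" "restrict z ?P3 \<in> realizations t ?P3"
      by (auto intro: restrict_realizations)
    then have "f1 (restrict z ?P1) \<in> bit_strings (code_length ?K ?P1 t)"
      "f3 (restrict z ?P3) \<in> bit_strings (code_length ?K ?P3 t)"
      using f1(1) f3(1) by blast+
    then show "enc1 z \<in> bit_strings (code_length ?K ?P1 t + code_length ?K ?P3 t)"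
      by (simp add: enc1_def bit_strings_def)
  qed
  moreover have "enc2 \<in> realizations t M2 \<rightarrow> bit_strings (code_length ?K ?P2 t)"
    using f2(1) restrict_realizations[of _ t M2 ?P2] by (auto simp: enc2_def)
  ultimately have "two_sender_index_code D M1 M2 t (code_length ?K ?P1 t + code_length ?K ?P3 t)
      (code_length ?K ?P2 t) enc1 enc2 dec"
    by (simp add: two_sender_index_code_def)
  then have "two_sender_length D M1 M2 t
      \<le> (code_length ?K ?P1 t + code_length ?K ?P3 t) + code_length ?K ?P2 t"
    unfolding two_sender_length_def by (intro Least_le) blast
  then show ?thesis by simp
qed

lemma code_rate_le_two_sender_rate:
  assumes "finite (verts D)" "M1 \<union> M2 = verts D"
  shows "code_rate (out_neighborhood D) (verts D) \<le> two_sender_rate D M1 M2"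
  unfolding two_sender_rate_alt
proof (rule cINF_greatest)
  fix t :: nat assume "t \<in> {1..}"
  then have "code_rate (out_neighborhood D) (verts D)
      \<le> real (code_length (out_neighborhood D) (verts D) t) / real t"
    by (intro code_rate_le) simp
  also have "\<dots> \<le> real (two_sender_length D M1 M2 t) / real t"
    using code_length_le_two_sender[OF assms] by (intro divide_right_mono) auto
  finally show "code_rate (out_neighborhood D) (verts D)
    \<le> real (two_sender_length D M1 M2 t) / real t" .
qed simp

text \<open>Near-optimal message lengths of the three classes may differ, so all three codes are
  repeated up to the product of these lengths.\<close>

lemma two_sender_rate_le:
  assumes "finite (verts D)" "M1 \<union> M2 = verts D"
  shows "two_sender_rate D M1 M2 \<le> code_rate (out_neighborhood D) (M1 - M2)
    + code_rate (out_neighborhood D) (M2 - M1) + code_rate (out_neighborhood D) (M1 \<inter> M2)"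
proof (rule field_le_epsilon)
  let ?K = "out_neighborhood D"
  let ?P1 = "M1 - M2" and ?P2 = "M2 - M1" and ?P3 = "M1 \<inter> M2"
  fix e :: real assume "e > 0"
  then have e: "e / 3 > 0" by simp
  obtain t1 where t1: "t1 \<ge> 1" "real (code_length ?K ?P1 t1) / real t1 < code_rate ?K ?P1 + e / 3"
    using code_rate_approx[OF e] .
  obtain t2 where t2: "t2 \<ge> 1" "real (code_length ?K ?P2 t2) / real t2 < code_rate ?K ?P2 + e / 3"
    using code_rate_approx[OF e] .
  obtain t3 where t3: "t3 \<ge> 1" "real (code_length ?K ?P3 t3) / real t3 < code_rate ?K ?P3 + e / 3"
    using code_rate_approx[OF e] .
  have fin: "finite M1" "finite M2" using assms by (metis finite_Un)+
  define T where "T = t1 * t2 * t3"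
  have T: "T = (t2 * t3) * t1" "T = (t1 * t3) * t2" "T = (t1 * t2) * t3" "T \<ge> 1"
    using t1(1) t2(1) t3(1) by (simp_all add: T_def)
  have len1: "real (code_length ?K ?P1 T) / real T \<le> real (code_length ?K ?P1 t1) / real t1"
    unfolding T(1) using fin t1(1) t2(1) t3(1) by (intro code_length_mult_rate) auto
  have len2: "real (code_length ?K ?P2 T) / real T \<le> real (code_length ?K ?P2 t2) / real t2"
    unfolding T(2) using fin t1(1) t2(1) t3(1) by (intro code_length_mult_rate) auto
  have len3: "real (code_length ?K ?P3 T) / real T \<le> real (code_length ?K ?P3 t3) / real t3"
    unfolding T(3) using fin t1(1) t2(1) t3(1) by (intro code_length_mult_rate) auto
  have "two_sender_rate D M1 M2 \<le> real (two_sender_length D M1 M2 T) / real T"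
    unfolding two_sender_rate_alt
    using T(4) by (intro cINF_lower) (auto intro!: bdd_belowI2[where m = 0])
  also have "\<dots> \<le> real (code_length ?K ?P1 T + code_length ?K ?P2 T + code_length ?K ?P3 T) / real T"
    by (intro divide_right_mono of_nat_mono two_sender_length_le[OF assms]) simp
  also have "\<dots> = real (code_length ?K ?P1 T) / real T + real (code_length ?K ?P2 T) / real T
      + real (code_length ?K ?P3 T) / real T"
    by (simp add: add_divide_distrib)
  finally show "two_sender_rate D M1 M2
      \<le> code_rate ?K ?P1 + code_rate ?K ?P2 + code_rate ?K ?P3 + e"
    using len1 len2 len3 t1(2) t2(2) t3(2) by linarith
qed

section \<open>Topological order and the three classes\<close>

lemma code_rate_split3:
  assumes fin: "finite A" "finite B" "finite C"
    and disj: "A \<inter> B = {}" "A \<inter> C = {}" "B \<inter> C = {}"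
    and K: "\<And>r. r \<in> B \<Longrightarrow> K r \<inter> A = {}" "\<And>r. r \<in> C \<Longrightarrow> K r \<inter> A = {}"
      "\<And>r. r \<in> C \<Longrightarrow> K r \<inter> B = {}"
  shows "code_rate K A + code_rate K B + code_rate K C \<le> code_rate K (A \<union> B \<union> C)"
proof -
  have "code_rate K A + code_rate K B \<le> code_rate K (A \<union> B)"
    using fin disj K by (intro code_rate_split) auto
  moreover have "code_rate K (A \<union> B) + code_rate K C \<le> code_rate K (A \<union> B \<union> C)"
    using fin disj K by (intro code_rate_split) blast+
  ultimately show ?thesis by linarith
qed

lemma acyclic_topological_order3:
  fixes G :: "(nat, nat \<times> nat) pre_digraph"
  assumes "acyclic_digraph G" "verts G = {1, 2, 3}" "tail G = fst" "head G = snd"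
  obtains i j k where "{i, j, k} = {1, 2, 3}" "i \<noteq> j" "i \<noteq> k" "j \<noteq> k"
    "(j, i) \<notin> arcs G" "(k, i) \<notin> arcs G" "(k, j) \<notin> arcs G"
proof -
  have two: "\<not> ((i, j) \<in> arcs G \<and> (j, i) \<in> arcs G)" if "i \<noteq> j" "{i, j} \<subseteq> {1, 2, 3}" for i j
  proof
    assume "(i, j) \<in> arcs G \<and> (j, i) \<in> arcs G"
    then have "pre_digraph.cycle G [(i, j), (j, i)]"
      using that assms(2-4)
      by (auto simp: pre_digraph.cycle_def pre_digraph.awalk_def pre_digraph.awalk_verts.simps
          pre_digraph.cas.simps)
    then show False using assms(1) by (auto simp: acyclic_digraph_def)
  qed
  have three: "\<not> ((i, j) \<in> arcs G \<and> (j, k) \<in> arcs G \<and> (k, i) \<in> arcs G)"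
    if "i \<noteq> j" "i \<noteq> k" "j \<noteq> k" "{i, j, k} \<subseteq> {1, 2, 3}" for i j k
  proof
    assume "(i, j) \<in> arcs G \<and> (j, k) \<in> arcs G \<and> (k, i) \<in> arcs G"
    then have "pre_digraph.cycle G [(i, j), (j, k), (k, i)]"
      using that assms(2-4)
      by (auto simp: pre_digraph.cycle_def pre_digraph.awalk_def pre_digraph.awalk_verts.simps
          pre_digraph.cas.simps)
    then show False using assms(1) by (auto simp: acyclic_digraph_def)
  qed
  \<comment> \<open>Up to rotation, these are all cycles without loops on three vertices: three
    pairs of opposite arcs and two orientations of the triangle. Excluding them leaves one of the
    six orders without backward arcs.\<close>
  note no_cycle = two[of 1 2] two[of 1 3] two[of 2 3] three[of 1 2 3] three[of 1 3 2]
  note orders = that[of 1 2 3] that[of 1 3 2] that[of 2 1 3] that[of 2 3 1] that[of 3 1 2]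
    that[of 3 2 1]
  show thesis using no_cycle orders by (simp add: insert_commute) metis
qed

theorem theorem4:
  fixes N :: nat and D :: "(nat, 'b) pre_digraph" and M1 M2 :: "nat set"
  assumes "digraph D"
    and "verts D = {1..N}"
    and "M1 \<union> M2 = verts D"
    and "acyclic_digraph (interaction_digraph D M1 M2)"
  shows "two_sender_rate D M1 M2 =
           rate (class_subgraph D M1 M2 1) + rate (class_subgraph D M1 M2 2)
           + rate (class_subgraph D M1 M2 3)
         \<and> rate (class_subgraph D M1 M2 1) + rate (class_subgraph D M1 M2 2)
           + rate (class_subgraph D M1 M2 3) = rate D"
proof -
  let ?K = "out_neighborhood D" and ?P = "message_class M1 M2"
  have fin: "finite (verts D)" using assms(2) by simp
  then have finP: "finite (?P i)" for i
    using assms(3) by (metis finite_Un finite_Diff finite_Int message_class_def)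
  have rate: "rate (class_subgraph D M1 M2 i) = code_rate ?K (?P i)" for i
    by (simp add: class_subgraph_def rate_induced)
  have P: "?P 1 = M1 - M2" "?P 2 = M2 - M1" "?P 3 = M1 \<inter> M2"
    by (simp_all add: message_class_def)
  have disj: "?P i \<inter> ?P j = {}" if "i \<noteq> j" "{i, j} \<subseteq> {1, 2, 3}" for i j
    using that by (auto simp: message_class_def)
  have arcs: "?K r \<inter> ?P j = {}"
    if "(i, j) \<notin> arcs (interaction_digraph D M1 M2)" "i \<noteq> j" "{i, j} \<subseteq> {1, 2, 3}" "r \<in> ?P i"
    for i j r
    using that by (auto simp: interaction_digraph_def class_subgraph_def out_neighborhood_def)
  obtain i j k where ijk: "{i, j, k} = {1, 2, 3}" "i \<noteq> j" "i \<noteq> k" "j \<noteq> k"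
    and no: "(j, i) \<notin> arcs (interaction_digraph D M1 M2)"
      "(k, i) \<notin> arcs (interaction_digraph D M1 M2)"
      "(k, j) \<notin> arcs (interaction_digraph D M1 M2)"
    by (rule acyclic_topological_order3[OF assms(4)]) (simp_all add: interaction_digraph_def)
  have in3: "i \<in> {1, 2, 3}" "j \<in> {1, 2, 3}" "k \<in> {1, 2, 3}" using ijk(1) by blast+
  have "code_rate ?K (?P i) + code_rate ?K (?P j) + code_rate ?K (?P k)
      \<le> code_rate ?K (?P i \<union> ?P j \<union> ?P k)"
    using ijk no in3 by (intro code_rate_split3 finP disj arcs) auto
  \<comment> \<open>Sum and union over \<open>{i, j, k}\<close> forget the topological order, so
    that the classes can be renumbered 1, 2, 3.\<close>
  moreover have "code_rate ?K (?P i) + code_rate ?K (?P j) + code_rate ?K (?P k)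
      = (\<Sum>l\<in>{i, j, k}. code_rate ?K (?P l))"
    using ijk(2-4) by simp
  moreover have "?P i \<union> ?P j \<union> ?P k = (\<Union>l\<in>{i, j, k}. ?P l)" by blast
  moreover have "(\<Union>l\<in>{1, 2, 3}. ?P l) = verts D" using assms(3) by (auto simp: message_class_def)
  ultimately have "code_rate ?K (?P 1) + code_rate ?K (?P 2) + code_rate ?K (?P 3)
      \<le> code_rate ?K (verts D)"
    unfolding ijk(1) by simp
  \<comment> \<open>The inequalities close a cycle: the single-sender rate is at most the two-sender
    rate, which is at most the sum, which is at most the single-sender rate.\<close>
  then show ?thesis
    using code_rate_le_two_sender_rate[OF fin assms(3)] two_sender_rate_le[OF fin assms(3)]
    unfolding rate rate_eq_code_rate[of D] P by linarith
qed

end
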